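(* Let $A$ be a complex affine Poisson algebra and $P$ a Poisson prime ideal of $A$. If $P$ is Poisson rational then $P$ is Poisson primitive.
   Context: A Poisson algebra over a field $k$ is a commutative $k$-algebra $A$ with a $k$-bilinear Lie bracket $\{-,-\}$ such that $\{-,x\}$ is a derivation of $A$ for every $x\in A$. An affine $k$-algebra is a finitely generated $k$-algebra that is an integral domain; "complex" means $k=\mathbb C$. A Poisson ideal is an ideal $I$ with $\{I,A\}\subseteq I$; a Poisson prime ideal is a prime ideal that is a Poisson ideal. A Poisson prime $P$ is Poisson primitive if it is the Poisson core (the largest Poisson ideal contained in) of some maximal ideal of $A$. A Poisson prime $P$ is Poisson rational if the Poisson centre $\{z : \{z,-\}\equiv 0\}$ of $\operatorname{Frac}(A/P)$ (with the bracket induced from $A$ and uniquely extended to the fraction field) is algebraic over the base field. *)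

theory Defs
  imports Complex_Main "HOL-Computational_Algebra.Fraction_Field"
    "HOL-Computational_Algebra.Polynomial"
begin

text \<open>A complex algebra structure on a commutative ring 'r is given by a ring
  homomorphism iota from the complex numbers into 'r; scalar multiplication
  c . x is iota c * x.\<close>

definition complex_alg :: "(complex \<Rightarrow> 'r::comm_ring_1) \<Rightarrow> bool" where
  "complex_alg \<iota> \<longleftrightarrow> \<iota> 1 = 1 \<and> (\<forall>c d. \<iota> (c + d) = \<iota> c + \<iota> d) \<and> (\<forall>c d. \<iota> (c * d) = \<iota> c * \<iota> d)"

definition poisson_bracket :: "(complex \<Rightarrow> 'r::comm_ring_1) \<Rightarrow> ('r \<Rightarrow> 'r \<Rightarrow> 'r) \<Rightarrow> bool" where
  "poisson_bracket \<iota> br \<longleftrightarrow>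
     (\<forall>x y z. br (x + y) z = br x z + br y z) \<and>
     (\<forall>x y z. br x (y + z) = br x y + br x z) \<and>
     (\<forall>c x y. br (\<iota> c * x) y = \<iota> c * br x y) \<and>
     (\<forall>c x y. br x (\<iota> c * y) = \<iota> c * br x y) \<and>
     (\<forall>x. br x x = 0) \<and>
     (\<forall>x y z. br x (br y z) + br y (br z x) + br z (br x y) = 0) \<and>
     (\<forall>x y z. br (y * z) x = y * br z x + z * br y x)"

definition poisson_algebra :: "(complex \<Rightarrow> 'r::comm_ring_1) \<Rightarrow> ('r \<Rightarrow> 'r \<Rightarrow> 'r) \<Rightarrow> bool" where
  "poisson_algebra \<iota> br \<longleftrightarrow> complex_alg \<iota> \<and> poisson_bracket \<iota> br"

inductive_set subalg_gen :: "(complex \<Rightarrow> 'r::comm_ring_1) \<Rightarrow> 'r set \<Rightarrow> 'r set"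
  for \<iota> :: "complex \<Rightarrow> 'r" and S :: "'r set" where
  gen: "x \<in> S \<Longrightarrow> x \<in> subalg_gen \<iota> S"
| scalar: "\<iota> c \<in> subalg_gen \<iota> S"
| add: "x \<in> subalg_gen \<iota> S \<Longrightarrow> y \<in> subalg_gen \<iota> S \<Longrightarrow> x + y \<in> subalg_gen \<iota> S"
| mult: "x \<in> subalg_gen \<iota> S \<Longrightarrow> y \<in> subalg_gen \<iota> S \<Longrightarrow> x * y \<in> subalg_gen \<iota> S"

text \<open>Affine: finitely generated as a complex algebra, and an integral domain
  (the latter is expressed by the type class idom on the carrier type).\<close>

definition finitely_generated :: "(complex \<Rightarrow> 'r::comm_ring_1) \<Rightarrow> bool" where
  "finitely_generated \<iota> \<longleftrightarrow> (\<exists>S. finite S \<and> subalg_gen \<iota> S = UNIV)"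

definition is_ideal :: "'r::comm_ring_1 set \<Rightarrow> bool" where
  "is_ideal I \<longleftrightarrow> 0 \<in> I \<and> (\<forall>x\<in>I. \<forall>y\<in>I. x + y \<in> I) \<and> (\<forall>r. \<forall>x\<in>I. r * x \<in> I)"

definition is_prime_ideal :: "'r::comm_ring_1 set \<Rightarrow> bool" where
  "is_prime_ideal I \<longleftrightarrow> is_ideal I \<and> I \<noteq> UNIV \<and> (\<forall>a b. a * b \<in> I \<longrightarrow> a \<in> I \<or> b \<in> I)"

definition is_maximal_ideal :: "'r::comm_ring_1 set \<Rightarrow> bool" where
  "is_maximal_ideal M \<longleftrightarrow> is_ideal M \<and> M \<noteq> UNIV \<and>
     (\<forall>J. is_ideal J \<and> M \<subseteq> J \<longrightarrow> J = M \<or> J = UNIV)"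

definition poisson_ideal :: "('r::comm_ring_1 \<Rightarrow> 'r \<Rightarrow> 'r) \<Rightarrow> 'r set \<Rightarrow> bool" where
  "poisson_ideal br I \<longleftrightarrow> is_ideal I \<and> (\<forall>x\<in>I. \<forall>a. br x a \<in> I)"

definition poisson_prime :: "('r::comm_ring_1 \<Rightarrow> 'r \<Rightarrow> 'r) \<Rightarrow> 'r set \<Rightarrow> bool" where
  "poisson_prime br P \<longleftrightarrow> is_prime_ideal P \<and> poisson_ideal br P"

definition is_poisson_core :: "('r::comm_ring_1 \<Rightarrow> 'r \<Rightarrow> 'r) \<Rightarrow> 'r set \<Rightarrow> 'r set \<Rightarrow> bool" where
  "is_poisson_core br M P \<longleftrightarrow> poisson_ideal br P \<and> P \<subseteq> M \<and>
     (\<forall>I. poisson_ideal br I \<and> I \<subseteq> M \<longrightarrow> I \<subseteq> P)"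

definition poisson_primitive :: "('r::comm_ring_1 \<Rightarrow> 'r \<Rightarrow> 'r) \<Rightarrow> 'r set \<Rightarrow> bool" where
  "poisson_primitive br P \<longleftrightarrow> poisson_prime br P \<and> (\<exists>M. is_maximal_ideal M \<and> is_poisson_core br M P)"

definition algebraic_over_C :: "(complex \<Rightarrow> 'k::comm_ring_1) \<Rightarrow> 'k \<Rightarrow> bool" where
  "algebraic_over_C \<iota> z \<longleftrightarrow>
     (\<exists>p :: complex poly. p \<noteq> 0 \<and> (\<Sum>i\<le>degree p. \<iota> (coeff p i) * z ^ i) = 0)"

text \<open>Poisson rationality of P.  The quotient A/P is represented by an arbitrary
  integral domain 'b together with a surjective ring homomorphism pi : A \<rightarrow> 'b
  with kernel P; Frac(A/P) is then the type 'b fract.  The bracket on Frac(A/P)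
  is the (unique) Poisson bracket on 'b fract extending the bracket induced from A,
  i.e. satisfying  {pi x / 1, pi y / 1} = pi {x,y} / 1.\<close>

definition quotient_map :: "('a::comm_ring_1 \<Rightarrow> 'b::comm_ring_1) \<Rightarrow> 'a set \<Rightarrow> bool" where
  "quotient_map \<pi> P \<longleftrightarrow> \<pi> 1 = 1 \<and> (\<forall>x y. \<pi> (x + y) = \<pi> x + \<pi> y) \<and>
     (\<forall>x y. \<pi> (x * y) = \<pi> x * \<pi> y) \<and> surj \<pi> \<and> {x. \<pi> x = 0} = P"

definition frac_embed :: "('a::comm_ring_1 \<Rightarrow> 'b::idom) \<Rightarrow> 'a \<Rightarrow> 'b fract" where
  "frac_embed \<pi> x = Fraction_Field.Fract (\<pi> x) 1"

definition induced_frac_bracket ::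
  "(complex \<Rightarrow> 'a::comm_ring_1) \<Rightarrow> ('a \<Rightarrow> 'a \<Rightarrow> 'a) \<Rightarrow> ('a \<Rightarrow> 'b::idom)
     \<Rightarrow> ('b fract \<Rightarrow> 'b fract \<Rightarrow> 'b fract) \<Rightarrow> bool" where
  "induced_frac_bracket \<iota> br \<pi> E \<longleftrightarrow>
     poisson_bracket (frac_embed \<pi> \<circ> \<iota>) E \<and>
     (\<forall>x y. E (frac_embed \<pi> x) (frac_embed \<pi> y) = frac_embed \<pi> (br x y))"

definition poisson_centre :: "('k \<Rightarrow> 'k \<Rightarrow> 'k::zero) \<Rightarrow> 'k set" where
  "poisson_centre E = {z. \<forall>w. E z w = 0}"

definition poisson_rational ::
  "(complex \<Rightarrow> 'a::comm_ring_1) \<Rightarrow> ('a \<Rightarrow> 'a \<Rightarrow> 'a) \<Rightarrow> ('a \<Rightarrow> 'b::idom) \<Rightarrow> 'a set \<Rightarrow> bool" where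
  "poisson_rational \<iota> br \<pi> P \<longleftrightarrow> poisson_prime br P \<and> quotient_map \<pi> P \<and>
     (\<forall>E. induced_frac_bracket \<iota> br \<pi> E \<longrightarrow>
        (\<forall>z \<in> poisson_centre E. algebraic_over_C (frac_embed \<pi> \<circ> \<iota>) z))"

end

theory Submission
  imports Defs
    "HOL-Analysis.Continuum_Not_Denumerable"
    "HOL-Computational_Algebra.Fundamental_Theorem_Algebra"
begin

text \<open>
  Let \<open>T\<close> range over the operators on \<open>A\<close> generated by the identity, multiplications and
  brackets; they preserve every Poisson ideal. Since the Poisson centre of \<open>Frac(A/P)\<close> is
  \<open>\<complex>\<close>, a density argument shows that for a finite-dimensional subspace \<open>V\<close> and \<open>f \<notin> V + P\<close>
  some \<open>T\<close> maps \<open>V\<close> into \<open>P\<close> but not \<open>f\<close>. By induction on the dimension of \<open>V\<close> this yields an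
  element \<open>D \<notin> P\<close> lying in every Poisson ideal \<open>I \<supseteq> P\<close> that meets \<open>(V + P) - P\<close>. As \<open>A\<close> has
  countable dimension, countably many such \<open>D\<close> serve all Poisson ideals, and since \<open>\<complex>\<close> is
  uncountable there is a maximal ideal \<open>M \<supseteq> P\<close> avoiding all of them; its Poisson core is \<open>P\<close>.
\<close>

section \<open>Maximal ideals of complex algebras of countable dimension\<close>

lemma is_idealD:
  assumes "is_ideal I"
  shows is_ideal_zero: "0 \<in> I"
    and is_ideal_add: "x \<in> I \<Longrightarrow> y \<in> I \<Longrightarrow> x + y \<in> I"
    and is_ideal_mult: "x \<in> I \<Longrightarrow> r * x \<in> I"
    and is_ideal_mult_right: "x \<in> I \<Longrightarrow> x * r \<in> I"
  using assms unfolding is_ideal_def by (auto simp: mult.commute)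

lemma is_ideal_uminus: "is_ideal I \<Longrightarrow> x \<in> I \<Longrightarrow> - x \<in> I"
  using is_ideal_mult[of I x "-1"] by simp

lemma is_ideal_diff: "is_ideal I \<Longrightarrow> x \<in> I \<Longrightarrow> y \<in> I \<Longrightarrow> x - y \<in> I"
  using is_ideal_add[of I x "- y"] is_ideal_uminus[of I y] by simp

lemma is_ideal_sum: "is_ideal I \<Longrightarrow> (\<And>x. x \<in> X \<Longrightarrow> f x \<in> I) \<Longrightarrow> sum f X \<in> I"
  by (induction X rule: infinite_finite_induct) (auto intro: is_ideal_zero is_ideal_add)

lemma is_ideal_one: "is_ideal I \<Longrightarrow> 1 \<in> I \<Longrightarrow> I = UNIV"
  using is_ideal_mult[of I 1] by auto

lemma is_prime_idealD:
  assumes "is_prime_ideal P"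
  shows is_prime_ideal_ideal: "is_ideal P"
    and is_prime_ideal_one: "1 \<notin> P"
    and is_prime_ideal_mult: "a * b \<in> P \<Longrightarrow> a \<in> P \<or> b \<in> P"
  using assms is_ideal_one unfolding is_prime_ideal_def by blast+

lemma is_ideal_set_plus:
  assumes "is_ideal I" "is_ideal J"
  shows "is_ideal {x + y | x y. x \<in> I \<and> y \<in> J}"
  unfolding is_ideal_def
proof (intro conjI ballI allI)
  show "0 \<in> {x + y | x y. x \<in> I \<and> y \<in> J}"
    using is_ideal_zero[OF assms(1)] is_ideal_zero[OF assms(2)] by force
next
  fix u v assume "u \<in> {x + y | x y. x \<in> I \<and> y \<in> J}" "v \<in> {x + y | x y. x \<in> I \<and> y \<in> J}"
  then obtain a b c d where "u = a + b" "v = c + d" "a \<in> I" "c \<in> I" "b \<in> J" "d \<in> J" by blast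
  then have "u + v = (a + c) + (b + d)" "a + c \<in> I" "b + d \<in> J"
    using assms by (auto intro: is_ideal_add)
  then show "u + v \<in> {x + y | x y. x \<in> I \<and> y \<in> J}" by blast
next
  fix r u assume "u \<in> {x + y | x y. x \<in> I \<and> y \<in> J}"
  then obtain a b where "u = a + b" "a \<in> I" "b \<in> J" by blast
  then have "r * u = r * a + r * b" "r * a \<in> I" "r * b \<in> J"
    using assms by (auto intro: is_ideal_mult simp: distrib_left)
  then show "r * u \<in> {x + y | x y. x \<in> I \<and> y \<in> J}" by blast
qed

text \<open>Elements \<open>a\<close>, \<open>b\<close> outside \<open>M\<close> have multiples
  congruent modulo \<open>M\<close> to some \<open>s\<close>, \<open>t\<close> in \<open>S\<close>,
  so \<open>a * b\<close> in \<open>M\<close> would put \<open>s * t\<close> in \<open>M\<close>.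
  The hypothesis \<open>meet\<close> expresses maximality among the ideals disjoint from
  \<open>S\<close>.\<close>

lemma prime_ideal_if_maximal_avoiding:
  assumes I: "is_ideal M" and one: "1 \<in> S" and S: "\<And>s t. s \<in> S \<Longrightarrow> t \<in> S \<Longrightarrow> s * t \<in> S"
    and disj: "M \<inter> S = {}"
    and meet: "\<And>a. a \<notin> M \<Longrightarrow> \<exists>b. \<exists>s\<in>S. a * b - s \<in> M"
  shows "is_prime_ideal M"
  unfolding is_prime_ideal_def
proof (intro conjI allI impI)
  show "M \<noteq> UNIV" using one disj by blast
  fix a b assume ab: "a * b \<in> M"
  show "a \<in> M \<or> b \<in> M"
  proof (rule ccontr)
    assume "\<not> (a \<in> M \<or> b \<in> M)"
    then obtain x y s t where st: "s \<in> S" "t \<in> S" "a * x - s \<in> M" "b * y - t \<in> M"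
      using meet by metis
    have "s * t = (a * b) * (x * y) - (a * x - s) * (b * y) - s * (b * y - t)"
      by (simp add: algebra_simps)
    also have "\<dots> \<in> M"
      using I ab st is_ideal_diff is_ideal_mult is_ideal_mult_right by metis
    finally show False using S[OF st(1,2)] disj by blast
  qed
qed (fact I)

text \<open>Zorn's lemma for the ideals that contain \<open>P\<close> and miss \<open>S\<close>.
  Maximality is stated through elements, by applying it to the ideal \<open>M + a A\<close>.\<close>

lemma exists_maximal_avoiding:
  assumes P: "is_ideal P" and disj: "P \<inter> S = {}"
  obtains M where "is_ideal M" "P \<subseteq> M" "M \<inter> S = {}"
    "\<And>a. a \<notin> M \<Longrightarrow> \<exists>b. \<exists>s\<in>S. a * b - s \<in> M"
proof -
  define \<A> where "\<A> = {J. is_ideal J \<and> P \<subseteq> J \<and> J \<inter> S = {}}"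
  have "\<exists>M\<in>\<A>. \<forall>X\<in>\<A>. M \<subseteq> X \<longrightarrow> X = M"
  proof (rule subset_Zorn_nonempty)
    show "\<A> \<noteq> {}" using P disj by (auto simp: \<A>_def)
    fix \<C> assume ne: "\<C> \<noteq> {}" and ch: "subset.chain \<A> \<C>"
    have sub: "\<C> \<subseteq> \<A>" and tot: "\<And>X Y. X \<in> \<C> \<Longrightarrow> Y \<in> \<C> \<Longrightarrow> X \<subseteq> Y \<or> Y \<subseteq> X"
      using ch by (auto simp: subset.chain_def)
    have "is_ideal (\<Union>\<C>)"
      unfolding is_ideal_def
    proof (intro conjI ballI allI)
      show "0 \<in> \<Union>\<C>" using ne sub is_ideal_zero by (auto simp: \<A>_def)
      fix x assume x: "x \<in> \<Union>\<C>"
      show "r * x \<in> \<Union>\<C>" for r using x sub is_ideal_mult by (fastforce simp: \<A>_def)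
      fix y assume "y \<in> \<Union>\<C>"
      with x obtain X Y where XY: "x \<in> X" "y \<in> Y" "X \<in> \<C>" "Y \<in> \<C>" by blast
      then obtain Z where "Z \<in> \<C>" "x \<in> Z" "y \<in> Z" using tot[of X Y] by blast
      moreover from this have "x + y \<in> Z" using sub by (intro is_ideal_add) (auto simp: \<A>_def)
      ultimately show "x + y \<in> \<Union>\<C>" by blast
    qed
    moreover have "P \<subseteq> \<Union>\<C>" "\<Union>\<C> \<inter> S = {}" using ne sub unfolding \<A>_def by blast+
    ultimately show "\<Union>\<C> \<in> \<A>" by (simp add: \<A>_def)
  qed
  then obtain M where MA: "M \<in> \<A>" and maxA: "\<forall>X\<in>\<A>. M \<subseteq> X \<longrightarrow> X = M" ..
  from MA have M: "is_ideal M" "P \<subseteq> M" "M \<inter> S = {}" by (simp_all add: \<A>_def)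
  have max: "X = M" if "is_ideal X" "P \<subseteq> X" "X \<inter> S = {}" "M \<subseteq> X" for X
    using that maxA by (simp add: \<A>_def)
  moreover have "\<exists>b. \<exists>s\<in>S. a * b - s \<in> M" if a: "a \<notin> M" for a
  proof -
    let ?N = "{x + y | x y. x \<in> M \<and> y \<in> range ((*) a)}"
    have "is_ideal (range ((*) a))"
      unfolding is_ideal_def
    proof (intro conjI ballI allI)
      show "0 \<in> range ((*) a)" by (metis mult_zero_right rangeI)
      fix x assume "x \<in> range ((*) a)"
      then obtain x' where x': "x = a * x'" by blast
      show "r * x \<in> range ((*) a)" for r by (rule image_eqI[of _ _ "r * x'"]) (simp_all add: x' ac_simps)
      fix y assume "y \<in> range ((*) a)"
      then obtain y' where y': "y = a * y'" by blast
      show "x + y \<in> range ((*) a)"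
        by (rule image_eqI[of _ _ "x' + y'"]) (simp_all add: x' y' distrib_left)
    qed
    then have N: "is_ideal ?N" using M(1) by (intro is_ideal_set_plus)
    have MN: "M \<subseteq> ?N"
    proof
      fix x assume "x \<in> M"
      moreover have "x = x + a * 0" by simp
      ultimately show "x \<in> ?N" by blast
    qed
    have "a = 0 + a * 1" by simp
    then have "a \<in> ?N" using is_ideal_zero[OF M(1)] by blast
    then have "?N \<inter> S \<noteq> {}" using max[OF N _ _ MN] M(2) MN a by blast
    then obtain m b where "m \<in> M" "m + a * b \<in> S" by auto
    moreover have "a * b - (m + a * b) = - m" by simp
    ultimately show ?thesis using is_ideal_uminus[OF M(1)] by metis
  qed
  ultimately show thesis using that M by blast
qed

section \<open>Complex algebras as vector spaces, and evaluation of complex polynomials\<close>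

locale complex_algebra =
  fixes \<iota> :: "complex \<Rightarrow> 'a::comm_ring_1"
  assumes alg: "complex_alg \<iota>"
begin

lemma \<iota>_one [simp]: "\<iota> 1 = 1"
  and \<iota>_add: "\<iota> (c + d) = \<iota> c + \<iota> d"
  and \<iota>_mult: "\<iota> (c * d) = \<iota> c * \<iota> d"
  using alg by (auto simp: complex_alg_def)

lemma \<iota>_zero [simp]: "\<iota> 0 = 0"
  using \<iota>_add[of 0 0] by simp

lemma \<iota>_uminus: "\<iota> (- c) = - \<iota> c"
  using \<iota>_add[of c "- c"] by (simp add: eq_neg_iff_add_eq_0 add.commute)

lemma \<iota>_diff: "\<iota> (c - d) = \<iota> c - \<iota> d"
  using \<iota>_add[of c "- d"] by (simp add: \<iota>_uminus)

lemma \<iota>_unit: "c \<noteq> 0 \<Longrightarrow> \<iota> c * \<iota> (inverse c) = 1"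
  by (simp flip: \<iota>_mult)

lemma ideal_scalar_iff: "is_ideal I \<Longrightarrow> c \<noteq> 0 \<Longrightarrow> \<iota> c * x \<in> I \<longleftrightarrow> x \<in> I"
  by (metis \<iota>_unit is_ideal_mult mult.commute mult.left_commute mult.right_neutral)

sublocale vector_space "\<lambda>c x. \<iota> c * x"
  by unfold_locales (simp_all add: \<iota>_add \<iota>_mult algebra_simps)

definition peval :: "complex poly \<Rightarrow> 'a \<Rightarrow> 'a" where
  "peval p z = (\<Sum>i\<le>degree p. \<iota> (coeff p i) * z ^ i)"

lemma peval_altdef: "peval p z = poly (map_poly \<iota> p) z"
proof -
  have "poly (map_poly \<iota> p) z = (\<Sum>i\<le>degree (map_poly \<iota> p). \<iota> (coeff p i) * z ^ i)"
    by (simp add: poly_altdef coeff_map_poly)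
  also have "\<dots> = peval p z"
    unfolding peval_def
  proof (rule sum.mono_neutral_left)
    show "\<forall>i\<in>{..degree p} - {..degree (map_poly \<iota> p)}. \<iota> (coeff p i) * z ^ i = 0"
      using coeff_eq_0[of "map_poly \<iota> p"] by (auto simp: coeff_map_poly)
  qed (use map_poly_degree_leq[of \<iota> p] in auto)
  finally show ?thesis ..
qed

lemma peval_0 [simp]: "peval 0 z = 0"
  and peval_pCons [simp]: "peval (pCons a p) z = \<iota> a + z * peval p z"
  by (simp_all add: peval_altdef map_poly_pCons)

lemma peval_add: "peval (p + q) z = peval p z + peval q z"
  by (induction p q rule: poly_induct2) (simp_all add: \<iota>_add algebra_simps)

lemma peval_smult: "peval (smult c p) z = \<iota> c * peval p z"
  by (induction p) (simp_all add: \<iota>_mult algebra_simps)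

lemma peval_mult: "peval (p * q) z = peval p z * peval q z"
  by (induction p) (simp_all add: peval_add peval_smult algebra_simps)

lemma peval_sum: "peval (\<Sum>x\<in>X. f x) z = (\<Sum>x\<in>X. peval (f x) z)"
  by (induction X rule: infinite_finite_induct) (simp_all add: peval_add)

lemma peval_one [simp]: "peval 1 z = 1"
  by (simp add: one_pCons)

lemma peval_prod: "peval (\<Prod>x\<in>X. f x) z = (\<Prod>x\<in>X. peval (f x) z)"
  by (induction X rule: infinite_finite_induct) (simp_all add: peval_mult)

text \<open>Since \<complex> is algebraically closed, linear factors split off \<open>q\<close> one
  at a time, and a prime ideal containing the product contains one of them; a nonzero constant is a
  unit and cannot lie in \<open>M\<close>.\<close>

lemma peval_root_mod_prime:
  assumes M: "is_prime_ideal M" and "q \<noteq> 0" "peval q a \<in> M"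
  obtains r where "a - \<iota> r \<in> M"
proof -
  have "\<exists>r. a - \<iota> r \<in> M"
    using assms(2,3)
  proof (induction "degree q" arbitrary: q rule: less_induct)
    case less
    show ?case
    proof (cases "degree q = 0")
      case True
      then obtain c where "q = [:c:]" by (rule degree_eq_zeroE)
      then have "\<iota> c * 1 \<in> M" "c \<noteq> 0" using less.prems by auto
      then show ?thesis
        using ideal_scalar_iff[OF is_prime_ideal_ideal[OF M]] is_prime_ideal_one[OF M] by blast
    next
      case False
      then obtain r where "poly q r = 0"
        using fundamental_theorem_of_algebra[of q] by (auto simp: constant_degree)
      then obtain q' where q': "q = [:- r, 1:] * q'" by (auto simp: poly_eq_0_iff_dvd dvd_def)
      then have nz: "q' \<noteq> 0" using less.prems by auto
      then have "degree q' < degree q" unfolding q' by (subst degree_mult_eq) auto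
      moreover have "(a - \<iota> r) * peval q' a \<in> M"
        using less.prems(2) unfolding q' peval_mult by (simp add: \<iota>_uminus)
      ultimately show ?thesis
        using is_prime_ideal_mult[OF M] less.hyps[of q'] nz by blast
    qed
  qed
  then show thesis using that by blast
qed

text \<open>The fields over \<open>\<complex>\<close> of countable dimension are algebraic, because the elements
  \<open>1 / (a - c)\<close> for \<open>c \<in> \<complex>\<close> cannot all be linearly independent. This replaces the
  Nullstellensatz, and it is where the uncountability of \<open>\<complex>\<close> enters.\<close>

lemma residue_scalar:
  assumes M: "is_prime_ideal M" and S: "countable S" "M \<inter> S = {}"
    and G: "countable G" "span G = UNIV"
    and meet: "\<And>a. a \<notin> M \<Longrightarrow> \<exists>b. \<exists>s\<in>S. a * b - s \<in> M"
  obtains c where "a - \<iota> c \<in> M"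
proof (rule ccontr)
  note I = is_prime_ideal_ideal[OF M]
  assume "\<not> thesis"
  then have no: "a - \<iota> c \<notin> M" for c using that by blast
  \<comment> \<open>Modulo \<open>M\<close>, the fraction \<open>b c / s c\<close> serves as the
    inverse of \<open>a - \<iota> c\<close>; \<open>s c\<close> is nonzero there because
    \<open>M\<close> misses \<open>S\<close>.\<close>
  have "\<forall>c. \<exists>b s. s \<in> S \<and> (a - \<iota> c) * b - s \<in> M" using meet[OF no] by blast
  then obtain b s where bs: "\<And>c. s c \<in> S" "\<And>c. (a - \<iota> c) * b c - s c \<in> M" by metis
  have "\<exists>F. finite F \<and> F \<subseteq> G \<and> x \<in> span F" for x
  proof -
    have "x \<in> span G" using G(2) by simp
    then obtain t r where "finite t" "t \<subseteq> G" "x = (\<Sum>v\<in>t. \<iota> (r v) * v)"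
      unfolding span_explicit by blast
    then show ?thesis by (intro exI[of _ t]) (auto intro: span_sum span_scale span_base)
  qed
  then obtain F where F: "\<And>x. finite (F x)" "\<And>x. F x \<subseteq> G" "\<And>x. x \<in> span (F x)" by metis
  \<comment> \<open>There are only countably many pairs of a denominator \<open>s c\<close> and a
    finite support \<open>F (b c)\<close>, so one pair \<open>(s0, F0)\<close> is shared by
    uncountably many \<open>c\<close>. Their \<open>b c\<close> all lie in one finite-dimensional
    space.\<close>
  let ?Y = "S \<times> {A. finite A \<and> A \<subseteq> G}"
  have "countable ?Y" using S G by (intro countable_SIGMA countable_Collect_finite_subset)
  moreover have "(UNIV :: complex set) = (\<Union>y\<in>?Y. {c. (s c, F (b c)) = y})"
    using bs F by auto
  ultimately obtain y where y: "y \<in> ?Y" "uncountable {c. (s c, F (b c)) = y}"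
    using uncountable_UNIV_complex by (metis (no_types, lifting) countable_UN)
  obtain s0 F0 where y_eq: "y = (s0, F0)" by fastforce
  define U where "U = {c. (s c, F (b c)) = y}"
  have U: "infinite U" using y(2) unfolding U_def by (meson countable_finite)
  have s0: "s0 \<notin> M" using y S(2) y_eq by auto
  have bU: "(a - \<iota> c) * b c - s0 \<in> M" if "c \<in> U" for c
    using that bs(2)[of c] by (simp add: U_def y_eq)
  \<comment> \<open>Injectivity makes the image of \<open>U\<close> infinite, which forces a linear
    dependence inside \<open>span F0\<close>. If \<open>b c = b d\<close>, subtracting the two
    congruences puts \<open>\<iota> (d - c) * b c\<close> into \<open>M\<close>, and then
    \<open>s0\<close> as well.\<close>
  have inj: "inj_on b U"
  proof (rule inj_onI, rule ccontr)
    fix c d assume cd: "c \<in> U" "d \<in> U" "b c = b d" "c \<noteq> d"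
    have "\<iota> (d - c) * b c = ((a - \<iota> c) * b c - s0) - ((a - \<iota> d) * b d - s0)"
      by (simp add: cd(3) \<iota>_diff algebra_simps)
    also have "\<dots> \<in> M" using bU cd by (blast intro: is_ideal_diff[OF I])
    finally have "b c \<in> M" using cd(4) by (simp add: ideal_scalar_iff[OF I])
    moreover have "s0 = (a - \<iota> c) * b c - ((a - \<iota> c) * b c - s0)" by simp
    ultimately have "s0 \<in> M" using bU[OF cd(1)] I by (metis is_ideal_diff is_ideal_mult)
    then show False using s0 by simp
  qed
  have "b ` U \<subseteq> span F0" using F(3) by (auto simp: U_def y_eq)
  moreover have "finite F0" using y(1) by (simp add: y_eq)
  ultimately have "dependent (b ` U)"
    using independent_span_bound[of F0 "b ` U"] U inj by (auto simp: finite_image_iff)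
  then obtain T u v where T: "finite T" "T \<subseteq> b ` U" "(\<Sum>x\<in>T. \<iota> (u x) * x) = 0" "v \<in> T" "u v \<noteq> 0"
    unfolding dependent_explicit by blast
  then obtain C where C: "C \<subseteq> U" "T = b ` C" "finite C"
    using finite_subset_image[OF T(1,2)] by blast
  have injC: "inj_on b C" using inj C(1) by (rule inj_on_subset)
  define w where "w c = u (b c)" for c
  have lin: "(\<Sum>c\<in>C. \<iota> (w c) * b c) = 0"
    using T(3) by (simp add: C(2) sum.reindex[OF injC] w_def)
  obtain c0 where c0: "c0 \<in> C" "w c0 \<noteq> 0" using T(4,5) by (auto simp: C(2) w_def)
  \<comment> \<open>The numerator of the sum of the fractions \<open>w c / (X - c)\<close> over
    their common denominator. At \<open>c0\<close> only one term survives, so \<open>q\<close> is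
    nonzero.\<close>
  define q where "q = (\<Sum>c\<in>C. smult (w c) (\<Prod>d\<in>C-{c}. [:- d, 1:]))"
  have "poly q c0 = (\<Sum>c\<in>C. w c * (\<Prod>d\<in>C-{c}. c0 - d))"
    by (simp add: q_def poly_sum poly_prod)
  also have "\<dots> = w c0 * (\<Prod>d\<in>C-{c0}. c0 - d)"
    by (subst sum.remove[OF C(3) c0(1)])
      (use C(3) c0(1) in \<open>auto intro!: sum.neutral prod_zero\<close>)
  also have "\<dots> \<noteq> 0" using c0(2) C(3) by auto
  finally have q0: "q \<noteq> 0" by force
  have pq: "peval q a = (\<Sum>c\<in>C. \<iota> (w c) * (\<Prod>d\<in>C-{c}. a - \<iota> d))"
    by (simp add: q_def peval_sum peval_smult peval_prod \<iota>_uminus)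
  have "s0 * peval q a = - (\<Sum>c\<in>C. \<iota> (w c) * (\<Prod>d\<in>C-{c}. a - \<iota> d) * ((a - \<iota> c) * b c - s0))
      + (\<Prod>d\<in>C. a - \<iota> d) * (\<Sum>c\<in>C. \<iota> (w c) * b c)"
  proof -
    have "(\<Prod>d\<in>C. a - \<iota> d) * (\<Sum>c\<in>C. \<iota> (w c) * b c)
        = (\<Sum>c\<in>C. \<iota> (w c) * (\<Prod>d\<in>C-{c}. a - \<iota> d) * ((a - \<iota> c) * b c))"
      unfolding sum_distrib_left
      by (rule sum.cong) (simp_all add: prod.remove[OF C(3)] ac_simps)
    then show ?thesis
      by (simp add: pq sum_distrib_left sum_subtractf right_diff_distrib ac_simps)
  qed
  also have "\<dots> \<in> M"
    unfolding lin using I bU C(1)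
    by (intro is_ideal_add is_ideal_uminus is_ideal_sum is_ideal_mult) (auto intro: is_ideal_zero)
  finally have "peval q a \<in> M" using is_prime_ideal_mult[OF M] s0 by blast
  then show False using peval_root_mod_prime[OF M q0] no by blast
qed

text \<open>An ideal maximal among those avoiding \<open>S\<close> is in general only prime. Here
  \<open>residue_scalar\<close> makes every element outside \<open>M\<close> a nonzero scalar modulo
  \<open>M\<close>, so every larger ideal contains a unit.\<close>

theorem exists_maximal_ideal_avoiding:
  fixes P S :: "'a set"
  assumes P: "is_ideal P" and S: "countable S" "1 \<in> S" "\<And>s t. s \<in> S \<Longrightarrow> t \<in> S \<Longrightarrow> s * t \<in> S"
    and disj: "P \<inter> S = {}" and G: "countable G" "span G = UNIV"
  obtains M where "is_maximal_ideal M" "P \<subseteq> M" "M \<inter> S = {}"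
proof -
  obtain M where M: "is_ideal M" "P \<subseteq> M" "M \<inter> S = {}"
    and meet: "\<And>a. a \<notin> M \<Longrightarrow> \<exists>b. \<exists>s\<in>S. a * b - s \<in> M"
    using exists_maximal_avoiding[OF P disj] by blast
  have prime: "is_prime_ideal M"
    using prime_ideal_if_maximal_avoiding M meet S by blast
  have "J = UNIV" if J: "is_ideal J" "M \<subseteq> J" "J \<noteq> M" for J
  proof -
    obtain a where a: "a \<in> J" "a \<notin> M" using J by blast
    obtain c where c: "a - \<iota> c \<in> M" using residue_scalar[OF prime S(1) M(3) G meet] by blast
    then have "c \<noteq> 0" using a by auto
    moreover have "\<iota> c * 1 \<in> J"
      using is_ideal_diff[OF J(1) a(1), of "a - \<iota> c"] c J(2) by auto
    ultimately show ?thesis using ideal_scalar_iff[OF J(1)] is_ideal_one[OF J(1)] by blast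
  qed
  then have "is_maximal_ideal M"
    using prime by (auto simp: is_maximal_ideal_def is_prime_ideal_def)
  then show thesis using that M by blast
qed

text \<open>The monomials in the generators, encoded as products of finite lists, span the algebra
  and are countable in number. Their span is closed under products by linearity in one factor after
  the other.\<close>

lemma countable_spanning_set:
  assumes "finitely_generated \<iota>"
  obtains G where "countable G" "span G = UNIV"
proof -
  obtain S where S: "finite S" "subalg_gen \<iota> S = UNIV"
    using assms by (auto simp: finitely_generated_def)
  let ?G = "prod_list ` lists S"
  have mult: "x * y \<in> span ?G" if x: "x \<in> span ?G" and y: "y \<in> span ?G" for x y
  proof -
    have *: "m * y \<in> span ?G" if "m \<in> ?G" for m
      using y
    proof (induction rule: span_induct_alt)
      case (step c z w)
      have "m * z \<in> ?G"
        using \<open>m \<in> ?G\<close> step(1) by (auto simp flip: prod_list.append intro!: imageI)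
      then have "\<iota> c * (m * z) + m * w \<in> span ?G"
        by (intro span_add span_scale step) (rule span_base)
      then show ?case by (simp add: algebra_simps)
    qed (simp add: span_zero)
    show ?thesis
      using x
    proof (induction rule: span_induct_alt)
      case (step c z w)
      then have "\<iota> c * (z * y) + w * y \<in> span ?G" using span_add span_scale * by blast
      then show ?case by (simp add: algebra_simps)
    qed (simp add: span_zero)
  qed
  have "x \<in> span ?G" if "x \<in> subalg_gen \<iota> S" for x
    using that
  proof induction
    case (gen x)
    then have "[x] \<in> lists S" by simp
    then have "prod_list [x] \<in> ?G" by (rule imageI)
    then show ?case by (intro span_base) simp
  next
    case (scalar c)
    have "prod_list [] \<in> ?G" by (rule imageI) simp
    then have "\<iota> c * 1 \<in> span ?G" by (intro span_scale span_base) simp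
    then show ?case by simp
  qed (auto intro: span_add mult)
  then have "span ?G = UNIV" using S(2) by auto
  moreover have "countable ?G" using S(1) by (intro countable_image countable_lists countable_finite)
  ultimately show thesis using that by blast
qed

end

section \<open>The Poisson bracket on the fraction field\<close>

text \<open>The target is a module over the source through \<phi>; maps such as
  \<open>\<lambda>y. \<phi> (br x y)\<close> are derivations in this sense.\<close>

definition derivation_along :: "('a::comm_ring_1 \<Rightarrow> 'k::comm_ring_1) \<Rightarrow> ('a \<Rightarrow> 'k) \<Rightarrow> bool" where
  "derivation_along \<phi> d \<longleftrightarrow>
     (\<forall>x y. d (x + y) = d x + d y) \<and> (\<forall>x y. d (x * y) = \<phi> x * d y + \<phi> y * d x)"

abbreviation derivation :: "('k::comm_ring_1 \<Rightarrow> 'k) \<Rightarrow> bool" where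
  "derivation \<equiv> derivation_along (\<lambda>u. u)"

lemma derivation_alongD:
  assumes "derivation_along \<phi> d"
  shows "d (x + y) = d x + d y" and "d (x * y) = \<phi> x * d y + \<phi> y * d x"
    and "d 0 = 0" and "d (- x) = - d x" and "d (x - y) = d x - d y"
proof -
  show add: "d (x + y) = d x + d y" for x y using assms by (simp add: derivation_along_def)
  show "d (x * y) = \<phi> x * d y + \<phi> y * d x" using assms by (simp add: derivation_along_def)
  show 0: "d 0 = 0" using add[of 0 0] by simp
  show neg: "d (- x) = - d x" for x using add[of x "- x"] 0 by (simp add: eq_neg_iff_add_eq_0 add.commute)
  show "d (x - y) = d x - d y" using add[of x "- y"] neg by simp
qed

lemma derivation_along_one: "derivation_along \<phi> d \<Longrightarrow> \<phi> 1 = 1 \<Longrightarrow> d 1 = 0"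
  using derivation_alongD(2)[of \<phi> d 1 1] by simp

lemma derivation_along_add:
  "derivation_along \<phi> d \<Longrightarrow> derivation_along \<phi> e \<Longrightarrow> derivation_along \<phi> (\<lambda>x. d x + e x)"
  by (auto simp: derivation_along_def algebra_simps)

lemma derivation_along_scale:
  "derivation_along \<phi> d \<Longrightarrow> derivation_along \<phi> (\<lambda>x. c * d x)"
  by (auto simp: derivation_along_def algebra_simps)

lemma derivation_along_uminus:
  "derivation_along \<phi> d \<Longrightarrow> derivation_along \<phi> (\<lambda>x. - d x)"
  by (auto simp: derivation_along_def algebra_simps)

lemma derivation_along_diff:
  "derivation_along \<phi> d \<Longrightarrow> derivation_along \<phi> e \<Longrightarrow> derivation_along \<phi> (\<lambda>x. d x - e x)"
  by (auto simp: derivation_along_def algebra_simps)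

lemma derivation_along_zero: "derivation_along \<phi> (\<lambda>x. 0)"
  by (auto simp: derivation_along_def)

lemma derivation_commutator:
  "derivation d \<Longrightarrow> derivation e \<Longrightarrow> derivation (\<lambda>u. d (e u) - e (d u))"
  by (auto simp: derivation_along_def algebra_simps)

section \<open>Derivations on a field of fractions\<close>

locale fraction_map =
  fixes \<phi> :: "'a::comm_ring_1 \<Rightarrow> 'k::field"
  assumes \<phi>_one [simp]: "\<phi> 1 = 1"
    and \<phi>_add: "\<phi> (x + y) = \<phi> x + \<phi> y"
    and \<phi>_mult: "\<phi> (x * y) = \<phi> x * \<phi> y"
    and fraction: "\<exists>x y. \<phi> y \<noteq> 0 \<and> u = \<phi> x / \<phi> y"
begin

lemma \<phi>_zero [simp]: "\<phi> 0 = 0"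
  using \<phi>_add[of 0 0] by (metis add.right_neutral add_left_imp_eq)

lemma \<phi>_uminus: "\<phi> (- x) = - \<phi> x"
  using \<phi>_add[of x "- x"] by (simp add: eq_neg_iff_add_eq_0 add.commute)

lemma \<phi>_diff: "\<phi> (x - y) = \<phi> x - \<phi> y"
  using \<phi>_add[of x "- y"] by (simp add: \<phi>_uminus)

text \<open>Applying a derivation to \<open>\<phi> x = u * \<phi> y\<close> determines its value at
  \<open>u\<close>. This uniqueness principle reduces identities for the extended bracket to
  identities in the ring, one argument at a time.\<close>

lemma derivation_eqI:
  assumes d: "derivation d" and e: "derivation e" and eq: "\<And>x. d (\<phi> x) = e (\<phi> x)"
  shows "d u = e u"
proof -
  obtain x y where y: "\<phi> y \<noteq> 0" and u: "u = \<phi> x / \<phi> y" using fraction by blast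
  then have x: "\<phi> x = u * \<phi> y" by simp
  have "u * d (\<phi> y) + \<phi> y * d u = u * e (\<phi> y) + \<phi> y * e u"
    using eq[of x] unfolding x derivation_alongD(2)[OF d] derivation_alongD(2)[OF e] .
  then show ?thesis using eq[of y] y by simp
qed

definition extend :: "('a \<Rightarrow> 'k) \<Rightarrow> 'k \<Rightarrow> 'k" where
  "extend d u =
     (SOME v. \<exists>x y. \<phi> y \<noteq> 0 \<and> u = \<phi> x / \<phi> y \<and> v = (\<phi> y * d x - \<phi> x * d y) / (\<phi> y)\<^sup>2)"

context
  fixes d :: "'a \<Rightarrow> 'k"
  assumes d: "derivation_along \<phi> d" and ker: "\<And>x. \<phi> x = 0 \<Longrightarrow> d x = 0"
begin

text \<open>The quotient rule does not depend on the chosen fraction: for two representations of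
  \<open>u\<close>, the element \<open>x * y' - x' * y\<close> lies in the kernel of \<phi>, so
  \<open>d\<close> kills it, and this says that \<open>(d x - u * d y) / \<phi> y\<close> is the
  same for both.\<close>

lemma extend_quotient:
  assumes y: "\<phi> y \<noteq> 0"
  shows "extend d (\<phi> x / \<phi> y) = (\<phi> y * d x - \<phi> x * d y) / (\<phi> y)\<^sup>2"
  unfolding extend_def
proof (rule someI2_ex)
  show "\<exists>v x' y'. \<phi> y' \<noteq> 0 \<and> \<phi> x / \<phi> y = \<phi> x' / \<phi> y' \<and> v = (\<phi> y' * d x' - \<phi> x' * d y') / (\<phi> y')\<^sup>2"
    using y by blast
next
  fix v assume "\<exists>x' y'. \<phi> y' \<noteq> 0 \<and> \<phi> x / \<phi> y = \<phi> x' / \<phi> y' \<and> v = (\<phi> y' * d x' - \<phi> x' * d y') / (\<phi> y')\<^sup>2"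
  then obtain x' y' where y': "\<phi> y' \<noteq> 0" and eq: "\<phi> x / \<phi> y = \<phi> x' / \<phi> y'"
    and v: "v = (\<phi> y' * d x' - \<phi> x' * d y') / (\<phi> y')\<^sup>2" by blast
  define u where "u = \<phi> x / \<phi> y"
  have x: "\<phi> x = u * \<phi> y" using y by (simp add: u_def)
  have x': "\<phi> x' = u * \<phi> y'" using y' by (simp add: u_def eq)
  have "\<phi> (x * y' - x' * y) = 0" by (simp add: \<phi>_diff \<phi>_mult x x')
  then have "d (x * y' - x' * y) = 0" by (rule ker)
  then have "\<phi> y' * (d x - u * d y) = \<phi> y * (d x' - u * d y')"
    by (simp add: derivation_alongD[OF d] x x' algebra_simps)
  then have "(d x - u * d y) / \<phi> y = (d x' - u * d y') / \<phi> y'"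
    using y y' by (simp add: field_simps)
  moreover have "(t * a - u * t * b) / t\<^sup>2 = (a - u * b) / t" if "t \<noteq> 0" for t a b :: 'k
    using that by (simp add: field_simps power2_eq_square)
  ultimately show "v = (\<phi> y * d x - \<phi> x * d y) / (\<phi> y)\<^sup>2"
    unfolding v x x' using y y' by simp
qed

lemma extend_\<phi>: "extend d (\<phi> x) = d x"
  using extend_quotient[of 1 x] derivation_along_one[OF d] by simp

lemma derivation_extend: "derivation (extend d)"
  unfolding derivation_along_def
proof (intro conjI allI)
  fix u v
  obtain x y where y: "\<phi> y \<noteq> 0" and u: "u = \<phi> x / \<phi> y" using fraction by blast
  obtain x' y' where y': "\<phi> y' \<noteq> 0" and v: "v = \<phi> x' / \<phi> y'" using fraction by blast
  have yy': "\<phi> (y * y') \<noteq> 0" using y y' by (simp add: \<phi>_mult)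
  have "u + v = \<phi> (x * y' + x' * y) / \<phi> (y * y')"
    using y y' by (simp add: u v \<phi>_add \<phi>_mult field_simps)
  then have "extend d (u + v) = (\<phi> (y * y') * d (x * y' + x' * y) - \<phi> (x * y' + x' * y) * d (y * y'))
      / (\<phi> (y * y'))\<^sup>2"
    by (simp only: extend_quotient[OF yy'])
  also have "\<dots> = extend d u + extend d v"
    using y y' unfolding u v extend_quotient[OF y] extend_quotient[OF y']
      \<phi>_add \<phi>_mult derivation_alongD[OF d]
    by (simp add: field_simps power2_eq_square)
  finally show "extend d (u + v) = extend d u + extend d v" .
  have "u * v = \<phi> (x * x') / \<phi> (y * y')"
    by (simp add: u v \<phi>_mult)
  then have "extend d (u * v) = (\<phi> (y * y') * d (x * x') - \<phi> (x * x') * d (y * y')) / (\<phi> (y * y'))\<^sup>2"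
    by (simp only: extend_quotient[OF yy'])
  also have "\<dots> = u * extend d v + v * extend d u"
    using y y' unfolding u v extend_quotient[OF y] extend_quotient[OF y']
      \<phi>_mult derivation_alongD[OF d]
    by (simp add: field_simps power2_eq_square)
  finally show "extend d (u * v) = u * extend d v + v * extend d u" .
qed

end

end

section \<open>Hamiltonian derivations and the induced Poisson bracket of fractions\<close>

locale poisson_fraction_map = fraction_map \<phi> for \<phi> :: "'a::comm_ring_1 \<Rightarrow> 'k::field" +
  fixes \<iota> :: "complex \<Rightarrow> 'a" and br :: "'a \<Rightarrow> 'a \<Rightarrow> 'a"
  assumes poisson: "poisson_algebra \<iota> br" and ker: "poisson_ideal br {x. \<phi> x = 0}"
begin

sublocale complex_algebra \<iota>
  using poisson by unfold_locales (simp add: poisson_algebra_def)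

lemma br_add_left: "br (x + y) z = br x z + br y z"
  and br_add_right: "br x (y + z) = br x y + br x z"
  and br_self: "br x x = 0"
  and br_scale_right: "br x (\<iota> c * y) = \<iota> c * br x y"
  and br_scale_left: "br (\<iota> c * x) y = \<iota> c * br x y"
  and br_jacobi: "br x (br y z) + br y (br z x) + br z (br x y) = 0"
  and br_mult_left: "br (y * z) x = y * br z x + z * br y x"
  using poisson unfolding poisson_algebra_def poisson_bracket_def by blast+

lemma br_skew: "br x y = - br y x"
proof -
  have "br x y + br y x = br (x + y) (x + y)"
    by (simp add: br_add_left br_add_right br_self[of x] br_self[of y])
  then show ?thesis by (simp add: br_self eq_neg_iff_add_eq_0)
qed

lemma br_mult_right: "br x (y * z) = y * br x z + z * br x y"
  using br_mult_left[of y z x] by (simp add: br_skew[of x])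

lemma ker_br_left: "\<phi> x = 0 \<Longrightarrow> \<phi> (br x y) = 0"
  using ker by (simp add: poisson_ideal_def)

lemma ker_br_right: "\<phi> y = 0 \<Longrightarrow> \<phi> (br x y) = 0"
  using ker_br_left[of y x] by (subst br_skew) (simp add: \<phi>_uminus)

definition hamiltonian :: "'a \<Rightarrow> 'k \<Rightarrow> 'k" where
  "hamiltonian x = extend (\<lambda>y. \<phi> (br x y))"

lemma derivation_along_br: "derivation_along \<phi> (\<lambda>y. \<phi> (br x y))"
  by (auto simp: derivation_along_def br_add_right br_mult_right \<phi>_add \<phi>_mult)

lemma derivation_hamiltonian: "derivation (hamiltonian x)"
  unfolding hamiltonian_def by (intro derivation_extend derivation_along_br ker_br_right)

lemma hamiltonian_\<phi>: "hamiltonian x (\<phi> y) = \<phi> (br x y)"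
  unfolding hamiltonian_def by (intro extend_\<phi> derivation_along_br ker_br_right)

text \<open>Both sides of each identity are derivations in \<open>v\<close>, so they are compared at
  \<open>v = \<phi> z\<close>, where the rules for \<open>br\<close> apply. With the second argument
  already extended, this permits extending the first one too.\<close>

lemma derivation_along_hamiltonian: "derivation_along \<phi> (\<lambda>x. hamiltonian x v)"
  unfolding derivation_along_def
proof (intro conjI allI)
  fix x y
  show "hamiltonian (x + y) v = hamiltonian x v + hamiltonian y v"
    by (rule derivation_eqI[OF derivation_hamiltonian derivation_along_add])
      (auto intro: derivation_hamiltonian simp: hamiltonian_\<phi> br_add_left \<phi>_add)
  show "hamiltonian (x * y) v = \<phi> x * hamiltonian y v + \<phi> y * hamiltonian x v"
    by (rule derivation_eqI[OF derivation_hamiltonian derivation_along_add[OF derivation_along_scale derivation_along_scale]])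
      (auto intro: derivation_hamiltonian simp: hamiltonian_\<phi> br_mult_left \<phi>_add \<phi>_mult)
qed

lemma hamiltonian_ker: "\<phi> x = 0 \<Longrightarrow> hamiltonian x v = 0"
  by (rule derivation_eqI[OF derivation_hamiltonian derivation_along_zero])
    (simp add: hamiltonian_\<phi> ker_br_left)

definition frac_bracket :: "'k \<Rightarrow> 'k \<Rightarrow> 'k" where
  "frac_bracket u v = extend (\<lambda>x. hamiltonian x v) u"

lemma frac_bracket_\<phi>_left: "frac_bracket (\<phi> x) v = hamiltonian x v"
  unfolding frac_bracket_def by (intro extend_\<phi> derivation_along_hamiltonian hamiltonian_ker)

lemma frac_bracket_\<phi>: "frac_bracket (\<phi> x) (\<phi> y) = \<phi> (br x y)"
  by (simp add: frac_bracket_\<phi>_left hamiltonian_\<phi>)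

lemma derivation_left: "derivation (\<lambda>u. frac_bracket u v)"
  unfolding frac_bracket_def
  by (intro derivation_extend derivation_along_hamiltonian hamiltonian_ker)

lemma derivation_right: "derivation (frac_bracket u)"
proof -
  obtain x y where y: "\<phi> y \<noteq> 0" and u: "u = \<phi> x / \<phi> y" using fraction by blast
  have "frac_bracket u = (\<lambda>v. inverse ((\<phi> y)\<^sup>2) * (\<phi> y * hamiltonian x v - \<phi> x * hamiltonian y v))"
    unfolding frac_bracket_def u
    by (subst extend_quotient[OF derivation_along_hamiltonian hamiltonian_ker y])
      (simp_all add: divide_inverse mult.commute)
  then show ?thesis
    by (simp add: derivation_along_scale derivation_along_diff derivation_hamiltonian)
qed

lemma frac_bracket_skew: "frac_bracket u v = - frac_bracket v u"
proof (rule derivation_eqI[OF derivation_left derivation_along_uminus[OF derivation_right]])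
  fix x
  show "frac_bracket (\<phi> x) v = - frac_bracket v (\<phi> x)"
    by (rule derivation_eqI[OF derivation_right derivation_along_uminus[OF derivation_left]])
      (simp add: frac_bracket_\<phi> br_skew[of x] \<phi>_uminus)
qed

lemma frac_bracket_self: "frac_bracket u u = 0"
proof -
  \<comment> \<open>Skew-symmetry only yields \<open>2 * frac_bracket u u = 0\<close>; 2 is nonzero
    because the image of \<open>1 / 2\<close> inverts it.\<close>
  have "\<phi> (\<iota> 2) * \<phi> (\<iota> (1 / 2)) = 1" by (simp flip: \<phi>_mult \<iota>_mult)
  moreover have "\<phi> (\<iota> 2) = 2"
    using \<phi>_add[of 1 1] \<iota>_add[of 1 1] by simp
  ultimately have "(2 :: 'k) \<noteq> 0" by auto
  moreover have "2 * frac_bracket u u = 0"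
    using frac_bracket_skew[of u u] unfolding eq_neg_iff_add_eq_0 mult_2 .
  ultimately show ?thesis by simp
qed

lemma frac_bracket_scale: "frac_bracket (\<phi> (\<iota> c) * u) v = \<phi> (\<iota> c) * frac_bracket u v"
proof -
  have "br (\<iota> c) y = 0" for y
  proof -
    have "br 1 y = 0" using br_mult_left[of 1 1 y] by simp
    then show ?thesis using br_scale_left[of c 1 y] by simp
  qed
  then have "hamiltonian (\<iota> c) (\<phi> x) = 0" for x by (simp add: hamiltonian_\<phi>)
  then have "hamiltonian (\<iota> c) v = 0"
    by (rule derivation_eqI[OF derivation_hamiltonian derivation_along_zero])
  then show ?thesis
    by (simp add: derivation_alongD(2)[OF derivation_left] frac_bracket_\<phi>_left)
qed

lemma frac_bracket_jacobi:
  "frac_bracket u (frac_bracket v w) + frac_bracket v (frac_bracket w u)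
     + frac_bracket w (frac_bracket u v) = 0"
proof -
  \<comment> \<open>As a commutator of derivations minus a derivation, the Jacobi sum is a
    derivation in \<open>w\<close>. Its cyclic symmetry then lets each of the three arguments in
    turn be reduced to the image of \<phi>.\<close>
  define J where "J u v w = frac_bracket u (frac_bracket v w) - frac_bracket v (frac_bracket u w)
     - frac_bracket (frac_bracket u v) w" for u v w
  have J_alt: "J u v w = frac_bracket u (frac_bracket v w) + frac_bracket v (frac_bracket w u)
     + frac_bracket w (frac_bracket u v)" for u v w
    unfolding J_def frac_bracket_skew[of w u] frac_bracket_skew[of w "frac_bracket u v"]
    by (simp add: derivation_alongD(4)[OF derivation_right])
  have cyc: "J u v w = J v w u" for u v w unfolding J_alt by (simp add: ac_simps)
  have "derivation (J u v)" for u v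
    unfolding J_def by (intro derivation_along_diff derivation_commutator derivation_right)
  then have gen: "J u v w = 0" if "\<And>z. J u v (\<phi> z) = 0" for u v w
    using derivation_eqI[OF _ derivation_along_zero] that by blast
  have "J (\<phi> x) (\<phi> y) (\<phi> z) = 0" for x y z
    unfolding J_alt frac_bracket_\<phi> using br_jacobi[of x y z] by (simp flip: \<phi>_add)
  then have "J (\<phi> x) (\<phi> y) w = 0" for x y w by (rule gen)
  then have "J v (\<phi> x) (\<phi> y) = 0" for v x y using cyc by metis
  then have "J v (\<phi> x) w = 0" for v x w by (rule gen)
  then have "J u v (\<phi> x) = 0" for u v x using cyc by metis
  then have "J u v w = 0" by (rule gen)
  then show ?thesis unfolding J_alt .
qed

lemma poisson_bracket_frac: "poisson_bracket (\<phi> \<circ> \<iota>) frac_bracket"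
proof -
  note L = derivation_alongD[OF derivation_left] and R = derivation_alongD[OF derivation_right]
  have "frac_bracket u (\<phi> (\<iota> c) * v) = \<phi> (\<iota> c) * frac_bracket u v" for u c v
    using frac_bracket_scale[of c v u] by (simp add: frac_bracket_skew[of u])
  then show ?thesis
    unfolding poisson_bracket_def o_def
    by (intro conjI allI L(1,2) R(1) frac_bracket_scale frac_bracket_self frac_bracket_jacobi)
qed

end

section \<open>Operators preserving Poisson ideals\<close>

text \<open>The additive subgroups stable under these operators are exactly the Poisson ideals. The
  clause \<open>diff\<close> serves the elimination in \<open>poisson_ops_separate\<close>.\<close>

inductive_set poisson_ops :: "('a::comm_ring_1 \<Rightarrow> 'a \<Rightarrow> 'a) \<Rightarrow> ('a \<Rightarrow> 'a) set"
  for br :: "'a \<Rightarrow> 'a \<Rightarrow> 'a" where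
  ident: "(\<lambda>x. x) \<in> poisson_ops br"
| mult: "T \<in> poisson_ops br \<Longrightarrow> (\<lambda>x. b * T x) \<in> poisson_ops br"
| diff: "T \<in> poisson_ops br \<Longrightarrow> U \<in> poisson_ops br \<Longrightarrow> (\<lambda>x. T x - U x) \<in> poisson_ops br"
| bracket: "T \<in> poisson_ops br \<Longrightarrow> (\<lambda>x. br y (T x)) \<in> poisson_ops br"

context poisson_fraction_map
begin

abbreviation P :: "'a set" where "P \<equiv> {x. \<phi> x = 0}"

lemma is_ideal_P: "is_ideal P"
  using ker by (simp add: poisson_ideal_def)

lemma poisson_ideal_br_right:
  assumes "poisson_ideal br I" "x \<in> I"
  shows "br y x \<in> I"
  using assms is_ideal_uminus[of I "br x y"] by (subst br_skew) (auto simp: poisson_ideal_def)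

lemma poisson_ops_preserve:
  assumes T: "T \<in> poisson_ops br" and I: "poisson_ideal br I"
  shows "x \<in> I \<Longrightarrow> T x \<in> I"
  using T by induction
    (use I poisson_ideal_br_right[OF I] is_ideal_mult is_ideal_diff in \<open>auto simp: poisson_ideal_def\<close>)

lemma poisson_ops_linear:
  assumes "T \<in> poisson_ops br"
  shows "T (x + y) = T x + T y" and "T (\<iota> c * x) = \<iota> c * T x"
proof -
  show "T (x + y) = T x + T y"
    using assms by induction (simp_all add: br_add_right algebra_simps)
  show "T (\<iota> c * x) = \<iota> c * T x"
    using assms by induction (simp_all add: br_scale_right right_diff_distrib mult.left_commute)
qed

lemma poisson_ops_zero:
  assumes "T \<in> poisson_ops br"
  shows "T 0 = 0"
  using poisson_ops_linear(2)[OF assms, of 0 0] by simp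

lemma poisson_ops_diff:
  assumes "T \<in> poisson_ops br"
  shows "T (x - y) = T x - T y"
  using poisson_ops_linear(1)[OF assms, of "x - y" y] by simp

text \<open>Adjoining \<open>P\<close> to \<open>F\<close> expresses spans in the quotient by
  \<open>P\<close> inside the ring itself. Being a Poisson ideal, \<open>P\<close> is preserved by
  \<open>T\<close>.\<close>

lemma poisson_ops_span:
  assumes T: "T \<in> poisson_ops br" and F: "\<And>x. x \<in> F \<Longrightarrow> \<phi> (T x) = 0" and x: "x \<in> span (F \<union> P)"
  shows "\<phi> (T x) = 0"
  using x
proof (induction rule: span_induct_alt)
  case base
  then show ?case using poisson_ops_zero[OF T] by simp
next
  case (step c z w)
  then have "\<phi> (T z) = 0" using F poisson_ops_preserve[OF T ker] by auto
  then show ?case using step by (simp add: poisson_ops_linear[OF T] \<phi>_add \<phi>_mult)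
qed

lemma central_if_kills_\<phi>:
  assumes "\<And>x. frac_bracket (\<phi> x) z = 0"
  shows "z \<in> poisson_centre frac_bracket"
proof -
  have "frac_bracket u z = 0" for u
    by (rule derivation_eqI[OF derivation_left derivation_along_zero]) (rule assms)
  then show ?thesis
    unfolding poisson_centre_def using frac_bracket_skew[of z] by simp
qed

end

section \<open>Separation by operators, and common elements of Poisson ideals\<close>

locale rational_poisson_fraction_map = poisson_fraction_map +
  assumes centre: "z \<in> poisson_centre frac_bracket \<Longrightarrow> z \<in> range (\<lambda>c. \<phi> (\<iota> c))"
begin

text \<open>This is the argument of the Jacobson density theorem: if every operator killing \<open>F\<close> and
  \<open>f'\<close> also kills \<open>f\<close>, then \<open>T f = \<alpha> T f'\<close> for all \<open>T\<close> killing \<open>F\<close>, with \<open>\<alpha>\<close> in the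
  fraction field. Replacing \<open>T\<close> by \<open>{x, T}\<close> shows that \<open>\<alpha>\<close> is central, hence a scalar.\<close>

lemma poisson_ops_separate:
  assumes "finite F" "f \<notin> span (F \<union> P)"
  shows "\<exists>T\<in>poisson_ops br. (\<forall>x\<in>F. \<phi> (T x) = 0) \<and> \<phi> (T f) \<noteq> 0"
  using assms
proof (induction F arbitrary: f rule: finite_induct)
  case empty
  then have "\<phi> f \<noteq> 0" using span_base[of f P] by auto
  then show ?case by (intro bexI[of _ "\<lambda>x. x"]) (auto intro: poisson_ops.ident)
next
  case (insert f' F)
  show ?case
  proof (cases "f' \<in> span (F \<union> P)")
    case True
    then have "f \<notin> span (F \<union> P)" using insert.prems by (simp add: span_redundant)
    then obtain T where T: "T \<in> poisson_ops br" "\<forall>x\<in>F. \<phi> (T x) = 0" "\<phi> (T f) \<noteq> 0"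
      using insert.IH by blast
    moreover have "\<phi> (T f') = 0" using poisson_ops_span[OF T(1) _ True] T(2) by blast
    ultimately show ?thesis by blast
  next
    case False
    then obtain T0 where T0: "T0 \<in> poisson_ops br" "\<forall>x\<in>F. \<phi> (T0 x) = 0" "\<phi> (T0 f') \<noteq> 0"
      using insert.IH by blast
    show ?thesis
    proof (rule ccontr)
      assume "\<not> ?thesis"
      then have none: "\<phi> (T f) = 0" if "T \<in> poisson_ops br" "\<forall>x\<in>F. \<phi> (T x) = 0" "\<phi> (T f') = 0" for T
        using that by blast
      define \<alpha> where "\<alpha> = \<phi> (T0 f) / \<phi> (T0 f')"
      have \<alpha>: "\<phi> (T f) = \<alpha> * \<phi> (T f')" if T: "T \<in> poisson_ops br" "\<forall>x\<in>F. \<phi> (T x) = 0" for T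
      proof -
        \<comment> \<open>This combination eliminates \<open>f'\<close>: modulo \<open>P\<close> it
          kills \<open>F\<close> and \<open>f'\<close>, hence also \<open>f\<close> by
          \<open>none\<close>, which is the desired proportionality.\<close>
        let ?S = "\<lambda>x. T0 f' * T x - T f' * T0 x"
        have "?S \<in> poisson_ops br" by (intro poisson_ops.intros T T0)
        moreover have "\<forall>x\<in>F. \<phi> (?S x) = 0" using T T0 by (simp add: \<phi>_diff \<phi>_mult)
        moreover have "\<phi> (?S f') = 0" by (simp add: mult.commute)
        ultimately have "\<phi> (?S f) = 0" by (rule none)
        then show ?thesis using T0(3) by (simp add: \<alpha>_def \<phi>_diff \<phi>_mult field_simps)
      qed
      have "frac_bracket (\<phi> x) \<alpha> = 0" for x
      proof -
        let ?S = "\<lambda>y. br x (T0 y)"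
        have "\<forall>y\<in>F. \<phi> (?S y) = 0" using T0(2) ker_br_right by blast
        then have "\<phi> (br x (T0 f)) = \<alpha> * \<phi> (br x (T0 f'))"
          using \<alpha>[of ?S] poisson_ops.bracket[OF T0(1)] by blast
        moreover have "\<phi> (br x (T0 f)) = frac_bracket (\<phi> x) (\<alpha> * \<phi> (T0 f'))"
          using \<alpha>[OF T0(1,2)] frac_bracket_\<phi>[of x "T0 f"] by simp
        ultimately have "\<phi> (T0 f') * frac_bracket (\<phi> x) \<alpha> = 0"
          by (simp add: derivation_alongD(2)[OF derivation_right] frac_bracket_\<phi>)
        then show ?thesis using T0(3) by simp
      qed
      then obtain c where c: "\<alpha> = \<phi> (\<iota> c)" using centre central_if_kills_\<phi> by blast
      \<comment> \<open>Now that \<alpha> is a scalar, it passes through \<open>T\<close>: every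
        operator sending \<open>F\<close> into \<open>P\<close> also sends
        \<open>f - \<iota> c * f'\<close> into \<open>P\<close>, so the induction hypothesis puts
        this element into the span.\<close>
      have "f - \<iota> c * f' \<in> span (F \<union> P)"
      proof (rule ccontr)
        assume "f - \<iota> c * f' \<notin> span (F \<union> P)"
        then obtain T where T: "T \<in> poisson_ops br" "\<forall>x\<in>F. \<phi> (T x) = 0" "\<phi> (T (f - \<iota> c * f')) \<noteq> 0"
          using insert.IH by blast
        then show False
          using \<alpha>[OF T(1,2)] by (simp add: poisson_ops_diff poisson_ops_linear \<phi>_diff \<phi>_mult c)
      qed
      then have "f \<in> span (insert f' F \<union> P)" by (auto simp: span_breakdown_eq)
      then show False using insert.prems by simp
    qed
  qed
qed

text \<open>Induction on \<open>F\<close>: for a new \<open>f\<close>, the old \<open>D\<close> is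
  multiplied by \<open>T f\<close>, where \<open>T\<close> sends \<open>F\<close> into
  \<open>P\<close> but not \<open>f\<close>. Let \<open>g\<close> in \<open>I\<close> outside
  \<open>P\<close> have coefficient \<open>c\<close> at \<open>f\<close>. If \<open>c = 0\<close>,
  the old \<open>D\<close> lies in \<open>I\<close>; otherwise \<open>T g\<close> shows that
  \<open>T f\<close> does. The product stays outside \<open>P\<close> because \<phi> takes values in
  a field.\<close>

lemma common_element_of_poisson_ideals:
  assumes "finite F"
  shows "\<exists>D. D \<notin> P \<and> (\<forall>I. poisson_ideal br I \<longrightarrow> P \<subseteq> I \<longrightarrow> I \<inter> span (F \<union> P) - P \<noteq> {} \<longrightarrow> D \<in> I)"
  using assms
proof (induction F rule: finite_induct)
  case empty
  \<comment> \<open>No ideal meets \<open>span P\<close> outside \<open>P\<close>, so the element 1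
    will do.\<close>
  have "span P \<subseteq> P"
    using is_ideal_P
    by (intro span_minimal) (auto simp: subspace_def \<phi>_add \<phi>_mult)
  then show ?case by (intro exI[of _ 1]) auto
next
  case (insert f F)
  then obtain D where D: "D \<notin> P"
    "\<And>I. poisson_ideal br I \<Longrightarrow> P \<subseteq> I \<Longrightarrow> I \<inter> span (F \<union> P) - P \<noteq> {} \<Longrightarrow> D \<in> I"
    by blast
  show ?case
  proof (cases "f \<in> span (F \<union> P)")
    case True
    then show ?thesis using D by (auto simp: span_redundant)
  next
    case False
    then obtain T where T: "T \<in> poisson_ops br" "\<forall>x\<in>F. \<phi> (T x) = 0" "\<phi> (T f) \<noteq> 0"
      using poisson_ops_separate[OF insert.hyps(1)] by blast
    have "D * T f \<in> I" if I: "poisson_ideal br I" "P \<subseteq> I" "I \<inter> span (insert f F \<union> P) - P \<noteq> {}" for I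
    proof -
      have ideal: "is_ideal I" using I(1) by (simp add: poisson_ideal_def)
      obtain g where g: "g \<in> I" "g \<notin> P" "g \<in> span (insert f F \<union> P)" using I(3) by blast
      then obtain c where c: "g - \<iota> c * f \<in> span (F \<union> P)" by (auto simp: span_breakdown_eq)
      show ?thesis
      proof (cases "c = 0")
        case True
        then have "D \<in> I" using D(2)[OF I(1,2)] c g by auto
        then show ?thesis by (rule is_ideal_mult_right[OF ideal])
      next
        case False
        have "\<phi> (T (g - \<iota> c * f)) = 0" using poisson_ops_span[OF T(1) _ c] T(2) by blast
        then have "T (g - \<iota> c * f) \<in> I" using I(2) by blast
        moreover have "\<iota> c * T f = T g - T (g - \<iota> c * f)"
          by (simp add: poisson_ops_diff[OF T(1)] poisson_ops_linear[OF T(1)])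
        ultimately have "\<iota> c * T f \<in> I"
          using is_ideal_diff[OF ideal] poisson_ops_preserve[OF T(1) I(1) g(1)] by simp
        then have "T f \<in> I" using False by (simp add: ideal_scalar_iff[OF ideal])
        then show ?thesis by (rule is_ideal_mult[OF ideal])
      qed
    qed
    moreover have "D * T f \<notin> P" using D(1) T(3) by (simp add: \<phi>_mult)
    ultimately show ?thesis by blast
  qed
qed

lemma poisson_core_of_maximal_ideal:
  assumes fg: "finitely_generated \<iota>"
  shows "\<exists>M. is_maximal_ideal M \<and> is_poisson_core br M P"
proof -
  obtain G where G: "countable G" "span G = UNIV" using countable_spanning_set[OF fg] .
  obtain D where D: "\<And>F. finite F \<Longrightarrow> D F \<notin> P"
    "\<And>F I. finite F \<Longrightarrow> poisson_ideal br I \<Longrightarrow> P \<subseteq> I \<Longrightarrow> I \<inter> span (F \<union> P) - P \<noteq> {} \<Longrightarrow> D F \<in> I"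
    using common_element_of_poisson_ideals by metis
  \<comment> \<open>Every element lies in the span of a finite subset of \<open>G\<close>, so these
    countably many elements serve all Poisson ideals. Their products form the multiplicative set
    \<open>S\<close> to be avoided.\<close>
  define \<D> where "\<D> = D ` {F. finite F \<and> F \<subseteq> G}"
  define S where "S = prod_list ` lists \<D>"
  have "countable S"
    unfolding S_def \<D>_def using G(1)
    by (intro countable_image countable_lists countable_Collect_finite_subset)
  moreover have "1 \<in> S" unfolding S_def by (rule image_eqI[of _ _ "[]"]) simp_all
  moreover have "s * t \<in> S" if "s \<in> S" "t \<in> S" for s t
    using that unfolding S_def by (auto simp flip: prod_list.append intro!: imageI)
  moreover have "P \<inter> S = {}"
  proof -
    have "\<phi> (prod_list xs) \<noteq> 0" if "set xs \<subseteq> \<D>" for xs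
      using that D(1) by (induction xs) (auto simp: \<phi>_mult \<D>_def)
    then show ?thesis by (auto simp: S_def lists_eq_set)
  qed
  ultimately obtain M where M: "is_maximal_ideal M" "P \<subseteq> M" "M \<inter> S = {}"
    using exists_maximal_ideal_avoiding[OF is_ideal_P _ _ _ _ G] by metis
  have "I \<subseteq> P" if I: "poisson_ideal br I" "I \<subseteq> M" for I
  proof (rule ccontr)
    assume "\<not> I \<subseteq> P"
    then obtain g where g: "g \<in> I" "g \<notin> P" by blast
    have idI: "is_ideal I" using I(1) by (simp add: poisson_ideal_def)
    \<comment> \<open>\<open>D\<close> is only known to lie in Poisson ideals containing
      \<open>P\<close>, so \<open>I\<close> is enlarged to \<open>I + P\<close>, which is still
      inside \<open>M\<close>.\<close>
    let ?J = "{x + y | x y. x \<in> I \<and> y \<in> P}"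
    have sub: "x \<in> ?J" if "x \<in> I \<or> x \<in> P" for x
    proof -
      have "x = x + 0" "x = 0 + x" "0 \<in> I" "0 \<in> P" using is_ideal_zero[OF idI] by simp_all
      then show ?thesis using that by blast
    qed
    have "br (x + y) a \<in> ?J" if "x \<in> I" "y \<in> P" for x y a
      using that I(1) ker unfolding br_add_left poisson_ideal_def by blast
    then have J: "poisson_ideal br ?J"
      using is_ideal_set_plus[OF idI is_ideal_P] unfolding poisson_ideal_def by blast
    have "g \<in> span G" using G(2) by simp
    then obtain F r where F: "finite F" "F \<subseteq> G" "g = (\<Sum>v\<in>F. \<iota> (r v) * v)"
      unfolding span_explicit by blast
    then have "g \<in> span (F \<union> P)" by (auto intro!: span_sum span_scale intro: span_base)
    then have "g \<in> ?J \<inter> span (F \<union> P) - P" using g sub by blast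
    then have "D F \<in> ?J" using D(2)[OF F(1) J] sub by blast
    then obtain x y where "D F = x + y" "x \<in> M" "y \<in> M" using I(2) M(2) by blast
    moreover have "is_ideal M" using M(1) by (simp add: is_maximal_ideal_def)
    ultimately have "D F \<in> M" by (simp add: is_ideal_add)
    moreover have "D F \<in> S"
      unfolding S_def by (rule image_eqI[of _ _ "[D F]"]) (use F in \<open>auto simp: \<D>_def\<close>)
    ultimately show False using M(3) by blast
  qed
  then have "is_poisson_core br M P" using ker M(2) by (auto simp: is_poisson_core_def)
  then show ?thesis using M(1) by blast
qed

end

section \<open>Specialisation to the fraction field of the quotient by \<open>P\<close>\<close>

theorem theorem3p2:
  fixes \<iota> :: "complex \<Rightarrow> 'a::idom"
    and br :: "'a \<Rightarrow> 'a \<Rightarrow> 'a"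
    and P :: "'a set"
    and \<pi> :: "'a \<Rightarrow> 'b::idom"
  assumes "poisson_algebra \<iota> br"
    and "finitely_generated \<iota>"
    and "poisson_prime br P"
    and "quotient_map \<pi> P"
    and "poisson_rational \<iota> br \<pi> P"
  shows "poisson_primitive br P"
proof -
  define \<phi> where "\<phi> = frac_embed \<pi>"
  have \<phi>_0: "\<phi> x = 0 \<longleftrightarrow> \<pi> x = 0" for x
    by (simp add: \<phi>_def frac_embed_def Zero_fract_def eq_fract)
  have P: "P = {x. \<phi> x = 0}"
    using assms(4) unfolding \<phi>_0 quotient_map_def by blast
  have frac: "\<exists>x y. \<phi> y \<noteq> 0 \<and> u = \<phi> x / \<phi> y" for u
  proof -
    obtain a b where u: "u = Fraction_Field.Fract a b" "b \<noteq> 0" by (cases u) auto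
    obtain x y where "a = \<pi> x" "b = \<pi> y"
      using assms(4) unfolding quotient_map_def surj_def by blast
    then show ?thesis
      using u \<phi>_0 by (intro exI[of _ x] exI[of _ y]) (simp add: \<phi>_def frac_embed_def)
  qed
  interpret fraction_map \<phi>
    by unfold_locales
      (use frac assms(4) in \<open>auto simp: \<phi>_def frac_embed_def quotient_map_def One_fract_def\<close>)
  interpret poisson_fraction_map \<phi> \<iota> br
    by unfold_locales (use assms(1,3) in \<open>auto simp: P poisson_prime_def\<close>)
  \<comment> \<open>Rationality quantifies over the induced brackets, so the constructed one must be
    recognised as such before its centre is known to be algebraic.\<close>
  have "induced_frac_bracket \<iota> br \<pi> frac_bracket"
    using poisson_bracket_frac frac_bracket_\<phi> by (simp add: induced_frac_bracket_def \<phi>_def)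
  then have alg: "algebraic_over_C (\<phi> \<circ> \<iota>) z" if "z \<in> poisson_centre frac_bracket" for z
    using assms(5) that by (simp add: poisson_rational_def \<phi>_def)
  interpret K: complex_algebra "\<phi> \<circ> \<iota>"
    by unfold_locales (simp add: complex_alg_def \<iota>_add \<iota>_mult \<phi>_add \<phi>_mult)
  \<comment> \<open>With the zero ideal of the field as prime ideal,
    \<open>K.peval_root_mod_prime\<close> turns an algebraic equation for a central \<open>z\<close>
    into \<open>z = \<phi> (\<iota> r)\<close>.\<close>
  have prime: "is_prime_ideal {0 :: 'b fract}"
    unfolding is_prime_ideal_def is_ideal_def by (auto, metis UNIV_I singletonD zero_neq_one)
  interpret rational_poisson_fraction_map \<phi> \<iota> br
  proof
    fix z assume "z \<in> poisson_centre frac_bracket"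
    then obtain p where "p \<noteq> 0" "K.peval p z \<in> {0}"
      using alg unfolding algebraic_over_C_def K.peval_def by blast
    then obtain r where "z - (\<phi> \<circ> \<iota>) r \<in> {0}" by (rule K.peval_root_mod_prime[OF prime])
    then show "z \<in> range (\<lambda>c. \<phi> (\<iota> c))" by simp
  qed
  show ?thesis
    using poisson_core_of_maximal_ideal[OF assms(2)] assms(3)
    unfolding poisson_primitive_def P by blast
qed

end
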